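(* Let $G$ be a finite simple graph. An edge $e=\{u,v\}$ of $G$ is a splitting edge of $G$ if and only if $N(u)\subseteq N(v)\cup\{v\}$ or $N(v)\subseteq N(u)\cup\{u\}$.
   Context: Graphs are undirected, without loops or multiple edges, not necessarily connected. The vertices of $G$ are identified with the variables of a polynomial ring $R=k[x_1,\dots,x_m]$ over a field $k$, and $\mathcal{I}(G)=(\{x_ix_j\mid\{x_i,x_j\}\in E_G\})\subseteq R$ is the edge ideal, where $E_G$ is the edge set of $G$. $N(x)$ is the set of neighbors of $x$ in $G$; $G\setminus e$ is $G$ with the edge $e$ deleted. $\mathcal{G}(I)$ is the minimal set of monomial generators of a monomial ideal $I$. An expression $I=J+K$ with $J,K$ nonzero monomial ideals is a splitting of $I$ if (1) $\mathcal{G}(I)$ is the disjoint union of $\mathcal{G}(J)$ and $\mathcal{G}(K)$, and (2) there is a function $\mathcal{G}(J\cap K)\to\mathcal{G}(J)\times\mathcal{G}(K)$, $w\mapsto(\phi(w),\psi(w))$, such that (a) $w=\mathrm{lcm}(\phi(w),\psi(w))$ for all $w\in\mathcal{G}(J\cap K)$, and (b) for every nonempty subset $S\subseteq\mathcal{G}(J\cap K)$, both $\mathrm{lcm}(\phi(S))$ and $\mathrm{lcm}(\psi(S))$ strictly divide $\mathrm{lcm}(S)$ (divide it and are not equal to it). An edge $e=\{u,v\}$ is a splitting edge of $G$ if $\mathcal{I}(G)=(uv)+\mathcal{I}(G\setminus e)$ is a splitting.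
   Formalization: The graph G is assumed to have at least one edge other than e; if e is its only edge, the ideal of G\e is zero, so e is not a splitting edge although N(u)={v} is contained in N(v)∪{v}, and the stated equivalence fails. *)

theory Defs
  imports Complex_Main "HOL-Library.Poly_Mapping" "HOL-Library.Set_Algebras"
begin

text \<open>The polynomial ring with coefficients in \<open>'k\<close> and one variable for each element of \<open>'v\<close>.
  The inner finitely supported functions are the exponent vectors of the monomials.\<close>

type_synonym 'v expo = "'v \<Rightarrow>\<^sub>0 nat"
type_synonym ('v, 'k) mpoly = "'v expo \<Rightarrow>\<^sub>0 'k"

definition mon :: "'v expo \<Rightarrow> ('v, 'k::field) mpoly" where
  "mon t = Poly_Mapping.single t 1"

definition Var :: "'v \<Rightarrow> ('v, 'k::field) mpoly" where
  "Var x = mon (Poly_Mapping.single x 1)"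

text \<open>Submodules of a commutative ring over itself are its ideals.\<close>

definition ideal_gen :: "'a::comm_ring_1 set \<Rightarrow> 'a set" where
  "ideal_gen B = module.span (*) B"

definition monomial_ideal :: "('v, 'k::field) mpoly set \<Rightarrow> bool" where
  "monomial_ideal I \<longleftrightarrow> (\<exists>M. I = ideal_gen (mon ` M))"

text \<open>A minimal set of monomial generators is represented by its set of exponent vectors.
  Every monomial ideal has exactly one such set; the value of \<open>min_gens\<close> on other sets
  is irrelevant.\<close>

definition is_min_gens :: "('v, 'k::field) mpoly set \<Rightarrow> 'v expo set \<Rightarrow> bool" where
  "is_min_gens I M \<longleftrightarrow>
     ideal_gen (mon ` M) = I \<and> (\<forall>M'. M' \<subset> M \<longrightarrow> ideal_gen (mon ` M') \<noteq> I)"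

definition min_gens :: "('v, 'k::field) mpoly set \<Rightarrow> 'v expo set" where
  "min_gens I = (THE M. is_min_gens I M)"

text \<open>The exponent vector of the least common multiple of a finite nonempty set of monomials.
  As \<open>'v\<close> is finite, every function has finite support.\<close>

definition lcm_mon :: "'v::finite expo set \<Rightarrow> 'v expo" where
  "lcm_mon S = Abs_poly_mapping (\<lambda>x. Max ((\<lambda>t. Poly_Mapping.lookup t x) ` S))"

definition splitting ::
  "('v::finite, 'k::field) mpoly set \<Rightarrow> ('v, 'k) mpoly set \<Rightarrow> ('v, 'k) mpoly set \<Rightarrow> bool"
where
  "splitting I J K \<longleftrightarrow>
     monomial_ideal J \<and> monomial_ideal K \<and> J \<noteq> {0} \<and> K \<noteq> {0} \<and> I = J + K \<and>
     min_gens I = min_gens J \<union> min_gens K \<and> min_gens J \<inter> min_gens K = {} \<and>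
     (\<exists>\<phi> \<psi>.
        (\<forall>w \<in> min_gens (J \<inter> K).
           \<phi> w \<in> min_gens J \<and> \<psi> w \<in> min_gens K \<and> w = lcm_mon {\<phi> w, \<psi> w}) \<and>
        (\<forall>S. S \<subseteq> min_gens (J \<inter> K) \<and> S \<noteq> {} \<longrightarrow>
           (mon (lcm_mon (\<phi> ` S)) :: ('v, 'k) mpoly) dvd mon (lcm_mon S) \<and>
           lcm_mon (\<phi> ` S) \<noteq> lcm_mon S \<and>
           (mon (lcm_mon (\<psi> ` S)) :: ('v, 'k) mpoly) dvd mon (lcm_mon S) \<and>
           lcm_mon (\<psi> ` S) \<noteq> lcm_mon S))"

text \<open>A simple graph whose vertices are all the elements of a finite type is given by its
  set of edges.\<close>

definition simple_graph :: "'v::finite set set \<Rightarrow> bool" where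
  "simple_graph E \<longleftrightarrow> (\<forall>e \<in> E. card e = 2)"

definition neighbors :: "'v set set \<Rightarrow> 'v \<Rightarrow> 'v set" where
  "neighbors E x = {y. {x, y} \<in> E}"

definition edge_ideal :: "'v set set \<Rightarrow> ('v, 'k::field) mpoly set" where
  "edge_ideal E = ideal_gen {Var x * Var y | x y. {x, y} \<in> E}"

text \<open>The first argument fixes the coefficient field.\<close>

definition splitting_edge :: "'k::field itself \<Rightarrow> 'v::finite set set \<Rightarrow> 'v \<Rightarrow> 'v \<Rightarrow> bool" where
  "splitting_edge _ E u v \<longleftrightarrow>
     {u, v} \<in> E \<and>
     splitting (edge_ideal E :: ('v, 'k) mpoly set)
       (ideal_gen {Var u * Var v}) (edge_ideal (E - {{u, v}}))"

end

theory Submission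
  imports Defs
begin

text \<open>All monomials that occur are square-free, so they can be treated as sets of vertices, with
  inclusion for divisibility and union for the least common multiple. The ideal
  \<open>(uv) \<inter> I(G \ e)\<close> is generated by the sets \<open>{u,v} \<union> B\<close> for the edges \<open>B \<noteq> e\<close>.

  If \<open>N(u) \<subseteq> N(v) \<union> {v}\<close>, every such set equals \<open>{u,v} \<union> B'\<close> for an edge \<open>B'\<close> that avoids \<open>u\<close>:
  replace \<open>B = {u,a}\<close> by \<open>{v,a}\<close>. Taking \<open>\<psi>({u,v} \<union> B) = B'\<close>, no \<open>lcm(\<psi>(S))\<close> is divisible by \<open>u\<close>,
  while \<open>lcm(\<phi>(S)) = uv\<close> misses the endpoint of \<open>B'\<close> outside \<open>e\<close>. Conversely, if \<open>x\<close> is a neighbour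
  of \<open>u\<close> only and \<open>y\<close> one of \<open>v\<close> only, then \<open>\<psi>(uvx) = ux\<close> and \<open>\<psi>(uvy) = vy\<close> are forced, and
  \<open>S = {uvx, uvy}\<close> satisfies \<open>lcm(\<psi>(S)) = uvxy = lcm(S)\<close>.\<close>

section \<open>Monomial ideals\<close>

abbreviation (input) lookup :: "('a \<Rightarrow>\<^sub>0 'b::zero) \<Rightarrow> 'a \<Rightarrow> 'b" where
  "lookup \<equiv> Poly_Mapping.lookup"

abbreviation (input) keys :: "('a \<Rightarrow>\<^sub>0 'b::zero) \<Rightarrow> 'a set" where
  "keys \<equiv> Poly_Mapping.keys"

text \<open>Makes the library facts on \<open>module.span\<close> available for
  \<open>ideal_gen\<close>.\<close>

lemma module_mult: "module ((*) :: 'a::comm_ring_1 \<Rightarrow> 'a \<Rightarrow> 'a)"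
  by unfold_locales (simp_all add: algebra_simps)

lemma mon_mult: "(mon s :: ('v, 'k::field) mpoly) * mon t = mon (s + t)"
  by (simp add: mon_def mult_single)

lemma keys_mon: "keys (mon t :: ('v, 'k::field) mpoly) = {t}"
  by (simp add: mon_def)

lemma mon_nonzero: "(mon t :: ('v, 'k::field) mpoly) \<noteq> 0"
  using keys_mon[of t] by (metis insert_not_empty keys_zero)

text \<open>Subtraction of exponents is truncated, so \<open>t - s\<close> is the exponent of a true
  quotient only under divisibility.\<close>

lemma expo_le_add_diff:
  fixes s t :: "'v expo"
  assumes "lookup s \<le> lookup t"
  shows "s + (t - s) = t"
  using assms by (intro poly_mapping_eqI) (simp add: lookup_add lookup_minus le_fun_def)

lemma mon_dvd_mon:
  assumes "lookup s \<le> lookup t"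
  shows "(mon s :: ('v, 'k::field) mpoly) dvd mon t"
  by (metis assms dvd_triv_left expo_le_add_diff mon_mult)

text \<open>The polynomials passing the termwise test form an ideal containing the generators.
  Conversely, \<open>p\<close> is the sum of its terms, and each term is a multiple of a
  generator.\<close>

lemma ideal_gen_mon_iff:
  fixes p :: "('v, 'k::field) mpoly"
  shows "p \<in> ideal_gen (mon ` M) \<longleftrightarrow> (\<forall>t \<in> keys p. \<exists>m \<in> M. lookup m \<le> lookup t)"
    (is "_ \<longleftrightarrow> ?P p")
proof
  assume "p \<in> ideal_gen (mon ` M)"
  then have "p \<in> module.span (*) (mon ` M)"
    by (simp add: ideal_gen_def)
  then show "?P p"
  proof (rule module.span_induct[OF module_mult])
    show "module.subspace (*) (Collect ?P)"
    proof (rule module.subspaceI[OF module_mult])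
      show "x + y \<in> Collect ?P" if "x \<in> Collect ?P" "y \<in> Collect ?P" for x y
        using that keys_add[of x y] by blast
      show "c * x \<in> Collect ?P" if x: "x \<in> Collect ?P" for c x
      proof (intro CollectI ballI)
        fix t assume "t \<in> keys (c * x)"
        then obtain a b where ab: "t = a + b" "b \<in> keys x"
          using keys_mult[of c x] by blast
        then obtain m where "m \<in> M" "lookup m \<le> lookup b"
          using x by blast
        then show "\<exists>m\<in>M. lookup m \<le> lookup t"
          using ab by (auto simp: le_fun_def lookup_add intro!: bexI[of _ m] trans_le_add2)
      qed
    qed simp
  qed (auto simp: keys_mon)
next
  assume P: "?P p"
  have "p = (\<Sum>t \<in> keys p. Poly_Mapping.single t (lookup p t))"
    by (rule poly_mapping_eqI)
      (auto simp: lookup_sum lookup_single when_def sum.delta' in_keys_iff)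
  also have "\<dots> \<in> module.span (*) (mon ` M)"
  proof (rule module.span_sum[OF module_mult])
    fix t assume "t \<in> keys p"
    then obtain m where m: "m \<in> M" "lookup m \<le> lookup t"
      using P by blast
    have "Poly_Mapping.single t (lookup p t)
        = Poly_Mapping.single (t - m) (lookup p t) * mon m"
      using expo_le_add_diff[OF m(2)] by (simp add: mon_def mult_single add.commute)
    also have "\<dots> \<in> module.span (*) (mon ` M)"
      using m(1) by (intro module.span_scale[OF module_mult] module.span_base[OF module_mult]) auto
    finally show "Poly_Mapping.single t (lookup p t) \<in> module.span (*) (mon ` M)" .
  qed
  finally show "p \<in> ideal_gen (mon ` M)"
    by (simp add: ideal_gen_def)
qed

lemma mon_in_ideal_gen_iff:
  "(mon t :: ('v, 'k::field) mpoly) \<in> ideal_gen (mon ` M) \<longleftrightarrow> (\<exists>m \<in> M. lookup m \<le> lookup t)"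
  by (simp add: ideal_gen_mon_iff keys_mon)

lemma ideal_gen_mon_nonzero:
  assumes "M \<noteq> {}"
  shows "ideal_gen (mon ` M) \<noteq> {0 :: ('v, 'k::field) mpoly}"
proof -
  obtain m where "m \<in> M"
    using assms by blast
  then have "(mon m :: ('v, 'k) mpoly) \<in> ideal_gen (mon ` M)"
    by (auto simp: mon_in_ideal_gen_iff)
  then show ?thesis
    using mon_nonzero[of m] by fastforce
qed

lemma ideal_gen_Un: "ideal_gen (A \<union> B) = ideal_gen A + ideal_gen B"
  by (auto simp: ideal_gen_def module.span_Un[OF module_mult] set_plus_def)

text \<open>If \<open>N\<close> generates \<open>I\<close> too, each \<open>m\<close> in
  \<open>M\<close> is a multiple of some \<open>n\<close> in \<open>N\<close>, itself a multiple of
  some \<open>m'\<close> in \<open>M\<close>. The antichain condition forces \<open>m' = m\<close>,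
  hence \<open>n = m\<close>. So \<open>M\<close> lies in every monomial generating set, which
  yields both minimality and the uniqueness that \<open>THE\<close> requires.\<close>

lemma min_gens_eqI:
  fixes I :: "('v, 'k::field) mpoly set"
  assumes gen: "ideal_gen (mon ` M) = I"
    and antichain: "\<And>s t. s \<in> M \<Longrightarrow> t \<in> M \<Longrightarrow> lookup s \<le> lookup t \<Longrightarrow> s = t"
  shows "min_gens I = M"
  unfolding min_gens_def
proof (rule the_equality)
  have subset: "M \<subseteq> N" if N: "ideal_gen (mon ` N) = I" for N
  proof
    fix m assume m: "m \<in> M"
    then have "(mon m :: ('v, 'k) mpoly) \<in> I"
      by (auto simp: gen[symmetric] mon_in_ideal_gen_iff)
    then obtain n where n: "n \<in> N" "lookup n \<le> lookup m"
      by (auto simp: N[symmetric] mon_in_ideal_gen_iff)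
    then have "(mon n :: ('v, 'k) mpoly) \<in> I"
      by (auto simp: N[symmetric] mon_in_ideal_gen_iff)
    then obtain m' where m': "m' \<in> M" "lookup m' \<le> lookup n"
      by (auto simp: gen[symmetric] mon_in_ideal_gen_iff)
    then have "m' = m"
      using antichain m n(2) order_trans by blast
    then have "lookup n = lookup m"
      using m'(2) n(2) by simp
    then show "m \<in> N"
      using n(1) by (simp add: lookup_inject)
  qed
  show "is_min_gens I M"
    unfolding is_min_gens_def using gen subset by blast
  show "N = M" if N: "is_min_gens I N" for N
  proof -
    have "M \<subseteq> N" "\<not> M \<subset> N"
      using N gen subset[of N] unfolding is_min_gens_def by blast+
    then show ?thesis by blast
  qed
qed

section \<open>Square-free monomials\<close>

definition sqfree :: "'v::finite set \<Rightarrow> 'v expo" where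
  "sqfree A = Abs_poly_mapping (\<lambda>x. of_bool (x \<in> A))"

lemma lookup_sqfree: "lookup (sqfree A) x = of_bool (x \<in> A)"
  by (simp add: sqfree_def)

lemma sqfree_le_iff: "lookup (sqfree A) \<le> lookup (sqfree B) \<longleftrightarrow> A \<subseteq> B"
  by (auto simp: le_fun_def lookup_sqfree of_bool_def split: if_splits)

lemma sqfree_eq_iff [simp]: "sqfree A = sqfree B \<longleftrightarrow> A = B"
  using sqfree_le_iff[of A B] sqfree_le_iff[of B A] by auto

lemma sqfree_Un_le_iff:
  "lookup (sqfree (A \<union> B)) \<le> lookup t \<longleftrightarrow>
    lookup (sqfree A) \<le> lookup t \<and> lookup (sqfree B) \<le> lookup t"
  by (auto simp: le_fun_def lookup_sqfree of_bool_def)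

text \<open>A pointwise maximum of indicator functions is the indicator of the union; nonemptiness
  keeps \<open>Max\<close> meaningful.\<close>

lemma lcm_mon_sqfree:
  assumes "\<A> \<noteq> {}"
  shows "lcm_mon (sqfree ` \<A>) = sqfree (\<Union>\<A>)"
proof -
  have "Max ((\<lambda>t. lookup t x) ` sqfree ` \<A>) = of_bool (x \<in> \<Union>\<A>)" for x
    using assms by (intro Max_eqI) (auto simp: image_image lookup_sqfree of_bool_def)
  then show ?thesis
    by (simp add: lcm_mon_def sqfree_def)
qed

lemma lcm_mon_sqfree2: "lcm_mon {sqfree A, sqfree B} = sqfree (A \<union> B)"
  using lcm_mon_sqfree[of "{A, B}"] by simp

lemma Var_mult_Var:
  fixes x y :: "'v::finite"
  assumes "x \<noteq> y"
  shows "(Var x * Var y :: ('v, 'k::field) mpoly) = mon (sqfree {x, y})"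
proof -
  have "Poly_Mapping.single x 1 + Poly_Mapping.single y 1 = sqfree {x, y}"
    using assms by (intro poly_mapping_eqI)
      (auto simp: lookup_add lookup_single lookup_sqfree when_def)
  then show ?thesis
    by (simp add: Var_def mon_mult)
qed

definition sqfree_ideal :: "'v::finite set set \<Rightarrow> ('v, 'k::field) mpoly set" where
  "sqfree_ideal \<A> = ideal_gen (mon ` sqfree ` \<A>)"

lemma in_sqfree_ideal_iff:
  "p \<in> sqfree_ideal \<A> \<longleftrightarrow> (\<forall>t \<in> keys p. \<exists>A \<in> \<A>. lookup (sqfree A) \<le> lookup t)"
  by (simp add: sqfree_ideal_def ideal_gen_mon_iff)

text \<open>By finiteness each member of \<open>\<A>\<close> contains an inclusion-minimal one, so
  the minimal members generate the same ideal, and they are pairwise incomparable.\<close>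

lemma min_gens_sqfree_ideal:
  "min_gens (sqfree_ideal \<A> :: ('v::finite, 'k::field) mpoly set) =
    sqfree ` {A \<in> \<A>. \<forall>B \<in> \<A>. B \<subseteq> A \<longrightarrow> B = A}"
    (is "_ = sqfree ` ?M")
proof (rule min_gens_eqI)
  have minimal: "\<exists>B \<in> ?M. B \<subseteq> A" if "A \<in> \<A>" for A
  proof -
    obtain B where "B \<in> \<A>" "B \<subseteq> A" "\<forall>C \<in> \<A>. C \<subseteq> B \<longrightarrow> B = C"
      using finite_has_minimal2[of \<A> A] \<open>A \<in> \<A>\<close> by auto
    then show ?thesis by blast
  qed
  have "(\<exists>A \<in> ?M. lookup (sqfree A) \<le> lookup t) \<longleftrightarrow> (\<exists>A \<in> \<A>. lookup (sqfree A) \<le> lookup t)"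
    for t :: "'v expo"
  proof
    assume "\<exists>A \<in> \<A>. lookup (sqfree A) \<le> lookup t"
    then obtain A where A: "A \<in> \<A>" "lookup (sqfree A) \<le> lookup t"
      by blast
    then obtain B where "B \<in> ?M" "B \<subseteq> A"
      using minimal by blast
    moreover have "lookup (sqfree B) \<le> lookup (sqfree A)"
      using \<open>B \<subseteq> A\<close> by (simp add: sqfree_le_iff)
    then have "lookup (sqfree B) \<le> lookup t"
      using A(2) by (rule order_trans)
    ultimately show "\<exists>A \<in> ?M. lookup (sqfree A) \<le> lookup t"
      by blast
  qed blast
  then have "sqfree_ideal ?M = (sqfree_ideal \<A> :: ('v, 'k) mpoly set)"
    by (intro set_eqI) (simp only: in_sqfree_ideal_iff)
  then show "ideal_gen (mon ` sqfree ` ?M) = (sqfree_ideal \<A> :: ('v, 'k) mpoly set)"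
    by (simp only: sqfree_ideal_def)
qed (auto simp: sqfree_le_iff)

text \<open>A monomial is divisible by two square-free monomials exactly when it is divisible by
  their lcm, the union.\<close>

lemma sqfree_ideal_Int:
  "(sqfree_ideal \<A> :: ('v::finite, 'k::field) mpoly set) \<inter> sqfree_ideal \<B> =
    sqfree_ideal {A \<union> B | A B. A \<in> \<A> \<and> B \<in> \<B>}"
proof -
  have "(\<exists>C \<in> {A \<union> B | A B. A \<in> \<A> \<and> B \<in> \<B>}. lookup (sqfree C) \<le> lookup t) \<longleftrightarrow>
      (\<exists>A \<in> \<A>. lookup (sqfree A) \<le> lookup t) \<and> (\<exists>B \<in> \<B>. lookup (sqfree B) \<le> lookup t)"
    for t :: "'v expo"
    using sqfree_Un_le_iff by blast
  then show ?thesis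
    by (intro set_eqI) (simp only: in_sqfree_ideal_iff Int_iff ball_conj_distrib)
qed

section \<open>Splitting edges\<close>

lemma simple_graph_edge:
  assumes "simple_graph E" "e \<in> E"
  obtains x y where "e = {x, y}" "x \<noteq> y"
  using assms unfolding simple_graph_def by (metis card_2_iff)

lemma simple_graph_subset:
  assumes "simple_graph E" "F \<subseteq> E"
  shows "simple_graph F"
  using assms by (auto simp: simple_graph_def)

lemma simple_graph_antichain:
  assumes "simple_graph E" "A \<in> E" "B \<in> E" "A \<subseteq> B"
  shows "A = B"
  using assms by (simp add: simple_graph_def card_subset_eq)

lemma edge_ideal_sqfree:
  assumes "simple_graph E"
  shows "(edge_ideal E :: ('v::finite, 'k::field) mpoly set) = sqfree_ideal E"
proof -
  \<comment> \<open>A loop would contribute a square \<open>Var x * Var x\<close>, which is not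
    square-free.\<close>
  have ne: "x \<noteq> y" if "{x, y} \<in> E" for x y
    using assms that by (auto simp: simple_graph_def)
  have "{Var x * Var y | x y. {x, y} \<in> E} = (mon ` sqfree ` E :: ('v, 'k) mpoly set)"
  proof (intro subset_antisym subsetI)
    fix p :: "('v, 'k) mpoly"
    assume "p \<in> {Var x * Var y | x y. {x, y} \<in> E}"
    then show "p \<in> mon ` sqfree ` E"
      using ne by (auto simp: Var_mult_Var)
  next
    fix p :: "('v, 'k) mpoly"
    assume "p \<in> mon ` sqfree ` E"
    then obtain e where e: "e \<in> E" "p = mon (sqfree e)"
      by blast
    obtain x y where "e = {x, y}" "x \<noteq> y"
      using simple_graph_edge assms e(1) by blast
    then show "p \<in> {Var x * Var y | x y. {x, y} \<in> E}"
      using e Var_mult_Var[of x y, symmetric] by blast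
  qed
  then show ?thesis
    by (simp add: edge_ideal_def sqfree_ideal_def)
qed

lemma min_gens_simple_graph:
  assumes "simple_graph E"
  shows "min_gens (sqfree_ideal E :: ('v::finite, 'k::field) mpoly set) = sqfree ` E"
  unfolding min_gens_sqfree_ideal using simple_graph_antichain[OF assms] by blast

text \<open>Only the choice of the two maps remains: the other clauses of \<open>splitting\<close>
  hold automatically, with a further edge making the second ideal nonzero. The first map is constant
  because \<open>uv\<close> is the only generator of its ideal.\<close>

lemma splitting_edge_iff:
  fixes E :: "'v::finite set set"
  assumes E: "simple_graph E" and uv: "{u, v} \<in> E" and "E \<noteq> {{u, v}}"
  defines "\<W> \<equiv> min_gens (sqfree_ideal {{u, v} \<union> B | B. B \<in> E - {{u, v}}} :: ('v, 'k::field) mpoly set)"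
  shows "splitting_edge TYPE('k) E u v \<longleftrightarrow>
    (\<exists>\<phi> \<psi>.
      (\<forall>w \<in> \<W>. \<phi> w = sqfree {u, v} \<and> \<psi> w \<in> sqfree ` (E - {{u, v}}) \<and> w = lcm_mon {\<phi> w, \<psi> w}) \<and>
      (\<forall>S. S \<subseteq> \<W> \<and> S \<noteq> {} \<longrightarrow>
        (mon (lcm_mon (\<phi> ` S)) :: ('v, 'k) mpoly) dvd mon (lcm_mon S) \<and>
        lcm_mon (\<phi> ` S) \<noteq> lcm_mon S \<and>
        (mon (lcm_mon (\<psi> ` S)) :: ('v, 'k) mpoly) dvd mon (lcm_mon S) \<and>
        lcm_mon (\<psi> ` S) \<noteq> lcm_mon S))"
proof -
  let ?F = "E - {{u, v}}"
  have graphs: "simple_graph {{u, v}}" "simple_graph ?F"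
    using E uv by (auto intro: simple_graph_subset)
  have "u \<noteq> v"
    using E uv by (auto simp: simple_graph_def)
  then have J: "ideal_gen {Var u * Var v} = (sqfree_ideal {{u, v}} :: ('v, 'k) mpoly set)"
    by (simp add: sqfree_ideal_def Var_mult_Var)
  have sum: "(sqfree_ideal E :: ('v, 'k) mpoly set) = sqfree_ideal {{u, v}} + sqfree_ideal ?F"
    using uv unfolding sqfree_ideal_def
    by (simp add: ideal_gen_Un[symmetric] image_Un[symmetric] insert_absorb flip: image_insert)
  have "?F \<noteq> {}"
    using assms by blast
  then have nonzero: "sqfree_ideal {{u, v}} \<noteq> {0 :: ('v, 'k) mpoly}"
      "sqfree_ideal ?F \<noteq> {0 :: ('v, 'k) mpoly}"
    unfolding sqfree_ideal_def by (intro ideal_gen_mon_nonzero; simp)+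
  have monomial: "monomial_ideal (sqfree_ideal \<A> :: ('v, 'k) mpoly set)" for \<A>
    by (auto simp: monomial_ideal_def sqfree_ideal_def)
  have inter: "(sqfree_ideal {{u, v}} :: ('v, 'k) mpoly set) \<inter> sqfree_ideal ?F =
      sqfree_ideal {{u, v} \<union> B | B. B \<in> ?F}"
    by (simp add: sqfree_ideal_Int)
  have gens: "sqfree ` E = sqfree ` {{u, v}} \<union> sqfree ` ?F" "sqfree ` {{u, v}} \<inter> sqfree ` ?F = {}"
    using uv by auto
  show ?thesis
    unfolding splitting_edge_def splitting_def J edge_ideal_sqfree[OF E]
      edge_ideal_sqfree[OF graphs(2)] min_gens_simple_graph[OF E]
      min_gens_simple_graph[OF graphs(1)] min_gens_simple_graph[OF graphs(2)] inter
      \<W>_def[symmetric]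
    using uv sum nonzero monomial gens by simp
qed

text \<open>Allows the second neighborhood inclusion to be treated as the first with
  \<open>u\<close> and \<open>v\<close> exchanged.\<close>

lemma splitting_edge_commute: "splitting_edge TYPE('k::field) E u v \<longleftrightarrow> splitting_edge TYPE('k) E v u"
  by (simp add: splitting_edge_def insert_commute mult.commute)

lemma splitting_edge_if_neighbors_subset:
  fixes E :: "'v::finite set set"
  assumes E: "simple_graph E" and uv: "{u, v} \<in> E" and ne: "E \<noteq> {{u, v}}"
    and sub: "neighbors E u \<subseteq> neighbors E v \<union> {v}"
  shows "splitting_edge TYPE('k::field) E u v"
proof -
  let ?F = "E - {{u, v}}"
  define \<W> where "\<W> = min_gens (sqfree_ideal {{u, v} \<union> B | B. B \<in> ?F} :: ('v, 'k) mpoly set)"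
  have "\<exists>B. B \<in> ?F \<and> u \<notin> B \<and> w = sqfree ({u, v} \<union> B)" if "w \<in> \<W>" for w
  proof -
    obtain B where B: "B \<in> ?F" "w = sqfree ({u, v} \<union> B)"
      using \<open>w \<in> \<W>\<close> by (auto simp: \<W>_def min_gens_sqfree_ideal)
    show ?thesis
    proof (cases "u \<in> B")
      case True
      then obtain a where a: "B = {u, a}" "a \<noteq> u"
        using B(1) simple_graph_edge[OF E, of B] by blast
      \<comment> \<open>\<open>B\<close> is not the edge \<open>{u, v}\<close>, so \<open>a\<close>
        is a neighbor of \<open>u\<close> other than \<open>v\<close>; the inclusion makes it a
        neighbor of \<open>v\<close>.\<close>
      then have "a \<noteq> v" "{v, a} \<in> E"
        using B(1) sub by (auto simp: neighbors_def)
      moreover have "u \<noteq> v"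
        using E uv by (auto simp: simple_graph_def)
      ultimately show ?thesis
        using a B(2) by (intro exI[of _ "{v, a}"]) (auto simp: doubleton_eq_iff insert_commute)
    next
      case False
      then show ?thesis using B by blast
    qed
  qed
  then obtain b where b: "\<And>w. w \<in> \<W> \<Longrightarrow> b w \<in> ?F \<and> u \<notin> b w \<and> w = sqfree ({u, v} \<union> b w)"
    by metis
  have lcms: "(mon (lcm_mon ((\<lambda>_. sqfree {u, v}) ` S)) :: ('v, 'k) mpoly) dvd mon (lcm_mon S) \<and>
      lcm_mon ((\<lambda>_. sqfree {u, v}) ` S) \<noteq> lcm_mon S \<and>
      (mon (lcm_mon ((\<lambda>w. sqfree (b w)) ` S)) :: ('v, 'k) mpoly) dvd mon (lcm_mon S) \<and>
      lcm_mon ((\<lambda>w. sqfree (b w)) ` S) \<noteq> lcm_mon S"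
    if S: "S \<subseteq> \<W>" "S \<noteq> {}" for S
  proof -
    \<comment> \<open>In this form \<open>lcm_mon_sqfree\<close> applies to
      \<open>S\<close>.\<close>
    have S_eq: "S = sqfree ` (\<lambda>w. {u, v} \<union> b w) ` S"
      using S(1) b by (force simp: image_image)
    have lcm_S: "lcm_mon S = sqfree ({u, v} \<union> (\<Union>w\<in>S. b w))"
      by (subst S_eq, subst lcm_mon_sqfree) (use S(2) in auto)
    have lcm_phi: "lcm_mon ((\<lambda>_. sqfree {u, v}) ` S) = sqfree {u, v}"
      using S(2) lcm_mon_sqfree[of "{{u, v}}"] by (simp add: image_constant_conv)
    have lcm_psi: "lcm_mon ((\<lambda>w. sqfree (b w)) ` S) = sqfree (\<Union>w\<in>S. b w)"
      using S(2) lcm_mon_sqfree[of "b ` S"] by (simp add: image_image)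
    obtain w where w: "w \<in> S"
      using S(2) by blast
    \<comment> \<open>Distinct edges are incomparable, so \<open>b w\<close> has a vertex outside
      \<open>{u, v}\<close>; this makes the divisibility for the first map strict.\<close>
    then have "\<not> b w \<subseteq> {u, v}"
      using b[of w] S(1) simple_graph_antichain[OF E _ uv, of "b w"] by blast
    then have "{u, v} \<noteq> {u, v} \<union> (\<Union>w\<in>S. b w)"
      using w by blast
    \<comment> \<open>For the second map strictness is witnessed by \<open>u\<close>.\<close>
    moreover have "u \<notin> (\<Union>w\<in>S. b w)"
      using b S(1) by blast
    then have "(\<Union>w\<in>S. b w) \<noteq> {u, v} \<union> (\<Union>w\<in>S. b w)"
      by blast
    ultimately show ?thesis
      unfolding lcm_S lcm_phi lcm_psi sqfree_eq_iff
      by (intro conjI mon_dvd_mon) (auto simp: sqfree_le_iff)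
  qed
  show ?thesis
    unfolding splitting_edge_iff[OF E uv ne] \<W>_def[symmetric]
  proof (intro exI conjI ballI allI impI)
    fix w assume "w \<in> \<W>"
    then show "sqfree (b w) \<in> sqfree ` ?F" and "w = lcm_mon {sqfree {u, v}, sqfree (b w)}"
      using b by (simp_all add: lcm_mon_sqfree2)
  qed (use lcms in auto)
qed

lemma neighbors_subset_if_splitting_edge:
  fixes E :: "'v::finite set set"
  assumes E: "simple_graph E" and uv: "{u, v} \<in> E" and ne: "E \<noteq> {{u, v}}"
    and split: "splitting_edge TYPE('k::field) E u v"
  shows "neighbors E u \<subseteq> neighbors E v \<union> {v} \<or> neighbors E v \<subseteq> neighbors E u \<union> {u}"
proof (rule ccontr)
  assume "\<not> ?thesis"
  then obtain x y where x: "{u, x} \<in> E" "{v, x} \<notin> E" "x \<noteq> v"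
    and y: "{v, y} \<in> E" "{u, y} \<notin> E" "y \<noteq> u"
    by (auto simp: neighbors_def)
  let ?F = "E - {{u, v}}"
  define \<W> where "\<W> = min_gens (sqfree_ideal {{u, v} \<union> B | B. B \<in> ?F} :: ('v, 'k) mpoly set)"
  obtain \<phi> \<psi> where
    gens: "\<forall>w \<in> \<W>. \<phi> w = sqfree {u, v} \<and> \<psi> w \<in> sqfree ` ?F \<and> w = lcm_mon {\<phi> w, \<psi> w}"
    and "\<forall>S. S \<subseteq> \<W> \<and> S \<noteq> {} \<longrightarrow>
        (mon (lcm_mon (\<phi> ` S)) :: ('v, 'k) mpoly) dvd mon (lcm_mon S) \<and>
        lcm_mon (\<phi> ` S) \<noteq> lcm_mon S \<and>
        (mon (lcm_mon (\<psi> ` S)) :: ('v, 'k) mpoly) dvd mon (lcm_mon S) \<and>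
        lcm_mon (\<psi> ` S) \<noteq> lcm_mon S"
    using split unfolding splitting_edge_iff[OF E uv ne] \<W>_def[symmetric]
    by (elim exE conjE)
  then have lcms: "lcm_mon (\<psi> ` S) \<noteq> lcm_mon S" if "S \<subseteq> \<W>" "S \<noteq> {}" for S
    using that by simp
  have "u \<noteq> x" "v \<noteq> y"
    using E uv x y by (auto simp: simple_graph_def)
  \<comment> \<open>The point is minimality: an edge other than \<open>{u, v}\<close> has a vertex
    outside \<open>{u, v}\<close>, so no union \<open>{u, v} \<union> B\<close> fits strictly inside
    \<open>{u, v, z}\<close>.\<close>
  have in_W: "sqfree {u, v, z} \<in> \<W>" if z: "{p, z} \<in> E" "p \<in> {u, v}" "z \<notin> {u, v}" for p z
  proof -
    have "{u, v, z} = {u, v} \<union> {p, z}" "{p, z} \<in> ?F"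
      using z by (auto simp: doubleton_eq_iff)
    moreover have "{u, v} \<union> B = {u, v, z}" if "B \<in> ?F" "{u, v} \<union> B \<subseteq> {u, v, z}" for B
      using that simple_graph_antichain[OF E _ uv, of B] by blast
    ultimately show ?thesis
      unfolding \<W>_def min_gens_sqfree_ideal by blast
  qed
  have psi: "\<psi> (sqfree {u, v, z}) = sqfree {p, z}"
    if z: "{p, z} \<in> E" "{q, z} \<notin> E" "{p, q} = {u, v}" "z \<notin> {u, v}" for p q z
  proof -
    have "sqfree {u, v, z} \<in> \<W>"
      using in_W z by blast
    then obtain B where B: "B \<in> ?F" "\<psi> (sqfree {u, v, z}) = sqfree B"
        "sqfree {u, v, z} = sqfree ({u, v} \<union> B)"
      using gens lcm_mon_sqfree2 by (metis (no_types, lifting) imageE)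
    \<comment> \<open>Since \<open>z\<close> is not in \<open>{u, v}\<close>, it must come from
      \<open>B\<close>. That leaves \<open>{p, z}\<close> and \<open>{q, z}\<close>, and the latter
      is not an edge.\<close>
    then have "B \<subseteq> {p, q, z}" "z \<in> B"
      using z by auto
    then have "B = {p, z} \<or> B = {q, z}"
      using B(1) simple_graph_edge[OF E, of B] z(3) by blast
    then show ?thesis
      using B z(2) by auto
  qed
  have psi_x: "\<psi> (sqfree {u, v, x}) = sqfree {u, x}"
    using psi[of u x v] x \<open>u \<noteq> x\<close> by blast
  have psi_y: "\<psi> (sqfree {u, v, y}) = sqfree {v, y}"
    using psi[of v y u] y \<open>v \<noteq> y\<close> by blast
  let ?S = "{sqfree {u, v, x}, sqfree {u, v, y}}"
  have "?S \<subseteq> \<W>"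
    using in_W[of u x] in_W[of v y] x y \<open>u \<noteq> x\<close> \<open>v \<noteq> y\<close> by blast
  \<comment> \<open>Both sides are the square-free monomial of \<open>{u, v, x, y}\<close>: the
    edges \<open>{u, x}\<close> and \<open>{v, y}\<close> already cover it.\<close>
  moreover have "lcm_mon (\<psi> ` ?S) = lcm_mon ?S"
    by (simp add: psi_x psi_y lcm_mon_sqfree2) blast
  ultimately show False
    using lcms by blast
qed

theorem theorem3p4:
  fixes E :: "'v::finite set set" and u v :: 'v
  assumes "simple_graph E" and "{u, v} \<in> E"
    and "E \<noteq> {{u, v}}"
  shows "splitting_edge TYPE('k::field) E u v \<longleftrightarrow>
    neighbors E u \<subseteq> neighbors E v \<union> {v} \<or> neighbors E v \<subseteq> neighbors E u \<union> {u}"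
proof
  assume "splitting_edge TYPE('k) E u v"
  then show "neighbors E u \<subseteq> neighbors E v \<union> {v} \<or> neighbors E v \<subseteq> neighbors E u \<union> {u}"
    using neighbors_subset_if_splitting_edge assms by blast
next
  assume "neighbors E u \<subseteq> neighbors E v \<union> {v} \<or> neighbors E v \<subseteq> neighbors E u \<union> {u}"
  then show "splitting_edge TYPE('k) E u v"
    using splitting_edge_if_neighbors_subset[OF assms]
      splitting_edge_if_neighbors_subset[of E v u] splitting_edge_commute assms
    by (metis insert_commute)
qed

end
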